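(* Let $R$ be a commutative ring with nonzero identity. Then the family $\mathfrak B=\{B_a:a\in R^\#\}$ is a basis for a topology on $EC(R^\#)$; denote the resulting space by $GD(R)$. Moreover, $B_a$ is the smallest open neighbourhood of $[a]$ for every $a\in R^\#$. Consequently, $GD(R)$ is an Alexandrov space.
   Context: For a commutative ring $R$ with nonzero identity and unit group $U(R)$, let $R^\#=R\setminus(U(R)\cup\{0\})$ be the set of nonzero nonunits. For $a,b\in R^\#$ write $a\sim b$ if $aR=bR$; $[a]$ denotes the equivalence class of $a$ and $EC(R^\#)$ the set of equivalence classes. For $a\in R^\#$ put $B_a=\{[b]\in EC(R^\#): b\mid a^n\text{ for some }n\geq 1\}$. A topological space is an Alexandrov space if every point has a smallest open neighbourhood (equivalently, arbitrary intersections of open sets are open). *)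

theory Defs
  imports "HOL-Analysis.Abstract_Topology" "HOL-Algebra.Ideal" "HOL-Algebra.Divisibility"
begin

section \<open>Bases and Alexandrov spaces\<close>

definition topology_base :: "'a topology \<Rightarrow> 'a set set \<Rightarrow> bool"
  where "topology_base T \<B> \<longleftrightarrow> openin T = arbitrary union_of (\<lambda>U. U \<in> \<B>)"

definition base_for_topology_on :: "'a set \<Rightarrow> 'a set set \<Rightarrow> bool"
  where "base_for_topology_on X \<B> \<longleftrightarrow> (\<exists>T. topspace T = X \<and> topology_base T \<B>)"

definition smallest_open_nhd :: "'a topology \<Rightarrow> 'a \<Rightarrow> 'a set \<Rightarrow> bool"
  where "smallest_open_nhd T x U \<longleftrightarrow>
    openin T U \<and> x \<in> U \<and> (\<forall>V. openin T V \<and> x \<in> V \<longrightarrow> U \<subseteq> V)"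

definition Alexandrov_space :: "'a topology \<Rightarrow> bool"
  where "Alexandrov_space T \<longleftrightarrow> (\<forall>x \<in> topspace T. \<exists>U. smallest_open_nhd T x U)"

section \<open>Classes of nonzero nonunits of a ring\<close>

definition nonzero_nonunits :: "('a, 'b) ring_scheme \<Rightarrow> 'a set"
  where "nonzero_nonunits R = carrier R - (Units R \<union> {\<zero>\<^bsub>R\<^esub>})"

definition assoc_rel :: "('a, 'b) ring_scheme \<Rightarrow> ('a \<times> 'a) set"
  where "assoc_rel R =
    {(a, b). a \<in> nonzero_nonunits R \<and> b \<in> nonzero_nonunits R \<and> PIdl\<^bsub>R\<^esub> a = PIdl\<^bsub>R\<^esub> b}"

definition assoc_class :: "('a, 'b) ring_scheme \<Rightarrow> 'a \<Rightarrow> 'a set"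
  where "assoc_class R a = assoc_rel R `` {a}"

definition EC :: "('a, 'b) ring_scheme \<Rightarrow> 'a set set"
  where "EC R = nonzero_nonunits R // assoc_rel R"

definition basic_open :: "('a, 'b) ring_scheme \<Rightarrow> 'a \<Rightarrow> 'a set set"
  where "basic_open R a =
    {assoc_class R b | b. b \<in> nonzero_nonunits R \<and>
       (\<exists>n::nat. n \<ge> 1 \<and> b divides\<^bsub>R\<^esub> (a [^]\<^bsub>R\<^esub> n))}"

definition basic_opens :: "('a, 'b) ring_scheme \<Rightarrow> 'a set set set"
  where "basic_opens R = {basic_open R a | a. a \<in> nonzero_nonunits R}"

text \<open>The function \<^term>\<open>topology\<close> is only meaningful on predicates that satisfy
  \<^term>\<open>istopology\<close>; that this is the case here is part of the claim that
  \<^term>\<open>basic_opens R\<close> is a base for a topology.\<close>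

definition GD :: "('a, 'b) ring_scheme \<Rightarrow> 'a set topology"
  where "GD R = topology (arbitrary union_of (\<lambda>U. U \<in> basic_opens R))"

end

theory Submission
  imports Defs
begin

text \<open>Write \<open>b \<preceq> a\<close> if \<open>b\<close> divides a power of \<open>a\<close>. This is a reflexive relation, and it is transitive
  because \<open>c dvd b ^ m\<close> and \<open>b dvd a ^ n\<close> give \<open>c dvd a ^ (n * m)\<close>. It also respects
  associatedness, since associated elements divide each other, so it descends to a preorder on
  the classes, and the sets \<open>B\<^sub>a\<close> are exactly its principal down-sets. Hence, if \<open>[c]\<close> lies in \<open>B\<^sub>a\<close>,
  then \<open>[c] \<in> B\<^sub>c \<subseteq> B\<^sub>a\<close>. The rest holds for the principal down-sets of any preorder: they form
  a base (lemma \<open>istopology_principal_sets\<close>), and every open set containing a point contains the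
  principal set of this point (lemma \<open>smallest_open_nhd_principal_set\<close>).\<close>

text \<open>The next two lemmas treat the principal down-sets \<open>N i\<close> of a preorder on the points \<open>p i\<close>,
  indexed by representatives; different indices may name the same point, as ring elements name
  their classes. The hypothesis \<open>down\<close> is transitivity. It gives the intersection property of a
  base in the strongest form: the principal set of a common point lies in the intersection.\<close>

lemma istopology_principal_sets:
  assumes refl: "\<And>i. i \<in> I \<Longrightarrow> p i \<in> N i"
    and points: "\<And>i. i \<in> I \<Longrightarrow> N i \<subseteq> p ` I"
    and down: "\<And>i j. i \<in> I \<Longrightarrow> j \<in> I \<Longrightarrow> p j \<in> N i \<Longrightarrow> N j \<subseteq> N i"
  shows "istopology (arbitrary union_of (\<lambda>U. U \<in> N ` I))"
  unfolding istopology_base_alt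
proof (intro allI impI)
  fix S T assume ST: "(arbitrary union_of (\<lambda>U. U \<in> N ` I)) S \<and> (arbitrary union_of (\<lambda>U. U \<in> N ` I)) T"
  have principal: "\<exists>j\<in>I. x = p j \<and> N j \<subseteq> V"
    if V: "(arbitrary union_of (\<lambda>U. U \<in> N ` I)) V" "x \<in> V" for x V
  proof -
    obtain U where "U \<in> N ` I" "x \<in> U" "U \<subseteq> V"
      using V unfolding arbitrary_union_of_alt by blast
    then obtain i where i: "i \<in> I" "x \<in> N i" "N i \<subseteq> V" by (elim imageE) simp
    then obtain j where j: "j \<in> I" "x = p j" using points[OF i(1)] by (meson imageE subsetD)
    with i down[of i j] have "N j \<subseteq> V" by simp
    with j show ?thesis by (intro bexI[of _ j] conjI)
  qed
  show "(arbitrary union_of (\<lambda>U. U \<in> N ` I)) (S \<inter> T)"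
    unfolding arbitrary_union_of_alt
  proof
    fix x assume x: "x \<in> S \<inter> T"
    obtain i where i: "i \<in> I" "x = p i" "N i \<subseteq> S" using principal[of S x] ST x by auto
    obtain j where j: "j \<in> I" "x = p j" "N j \<subseteq> T" using principal[of T x] ST x by auto
    \<comment> \<open>\<open>i\<close> and \<open>j\<close> are two names of the point \<open>x\<close>, so their principal sets coincide.\<close>
    have "N i \<subseteq> N j" using down[of j i] i j refl[OF j(1)] by simp
    with i j refl[OF i(1)] show "\<exists>U. U \<in> N ` I \<and> x \<in> U \<and> U \<subseteq> S \<inter> T"
      by (intro exI[of _ "N i"]) auto
  qed
qed

lemma smallest_open_nhd_principal_set:
  assumes base: "topology_base T (N ` I)"
    and refl: "\<And>i. i \<in> I \<Longrightarrow> p i \<in> N i"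
    and down: "\<And>i j. i \<in> I \<Longrightarrow> j \<in> I \<Longrightarrow> p j \<in> N i \<Longrightarrow> N j \<subseteq> N i"
    and i: "i \<in> I"
  shows "smallest_open_nhd T (p i) (N i)"
  unfolding smallest_open_nhd_def
proof (intro conjI allI impI)
  have op: "openin T V \<longleftrightarrow> (\<forall>x\<in>V. \<exists>U. U \<in> N ` I \<and> x \<in> U \<and> U \<subseteq> V)" for V
    using base unfolding topology_base_def by (simp add: arbitrary_union_of_alt)
  show "openin T (N i)" using op i by blast
  show "p i \<in> N i" using refl i .
  fix V assume V: "openin T V \<and> p i \<in> V"
  then obtain j where "j \<in> I" "p i \<in> N j" "N j \<subseteq> V" unfolding op by blast
  with down i show "N i \<subseteq> V" by blast
qed

lemma EC_eq_image: "EC R = assoc_class R ` nonzero_nonunits R"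
  unfolding EC_def assoc_class_def quotient_def by blast

lemma basic_opens_eq_image: "basic_opens R = basic_open R ` nonzero_nonunits R"
  unfolding basic_opens_def by blast

lemma (in cring) pow_divides_pow:
  assumes "a \<in> carrier R" "b \<in> carrier R" "a divides b"
  shows "a [^] (n::nat) divides b [^] n"
proof -
  from assms(3) obtain c where c: "c \<in> carrier R" "b = a \<otimes> c" by (rule dividesE)
  then have "b [^] n = a [^] n \<otimes> c [^] n" using assms(1) by (simp add: nat_pow_distrib)
  with c show ?thesis by (intro dividesI) auto
qed

text \<open>Well-definedness on classes: equal classes generate the same principal ideal, so their
  representatives divide each other.\<close>

lemma (in cring) assoc_class_eq_imp_divides:
  assumes a: "a \<in> nonzero_nonunits R" and b: "b \<in> nonzero_nonunits R"
    and eq: "assoc_class R a = assoc_class R b"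
  shows "a divides b"
proof -
  have "b \<in> assoc_class R b" using b by (simp add: assoc_class_def assoc_rel_def)
  then have "PIdl a = PIdl b" using eq by (auto simp: assoc_class_def assoc_rel_def)
  moreover have carr: "a \<in> carrier R" "b \<in> carrier R" using a b by (auto simp: nonzero_nonunits_def)
  ultimately have "b \<in> PIdl a" using cgenideal_self by simp
  then obtain c where "c \<in> carrier R" "b = c \<otimes> a" unfolding cgenideal_def by blast
  with carr show ?thesis by (intro dividesI[of c]) (auto simp: m_comm)
qed

lemma (in cring) assoc_class_in_basic_open_iff:
  assumes b: "b \<in> nonzero_nonunits R" and a: "a \<in> nonzero_nonunits R"
  shows "assoc_class R b \<in> basic_open R a \<longleftrightarrow> (\<exists>n::nat. n \<ge> 1 \<and> b divides a [^] n)"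
proof
  assume "assoc_class R b \<in> basic_open R a"
  then obtain c n where c: "c \<in> nonzero_nonunits R" "assoc_class R b = assoc_class R c"
    "(n::nat) \<ge> 1" "c divides a [^] n"
    unfolding basic_open_def by blast
  have "b divides c" using assoc_class_eq_imp_divides b c by blast
  moreover have "b \<in> carrier R" using b by (simp add: nonzero_nonunits_def)
  ultimately have "b divides a [^] n" using c(4) divides_trans by blast
  with c show "\<exists>n::nat. n \<ge> 1 \<and> b divides a [^] n" by blast
next
  assume "\<exists>n::nat. n \<ge> 1 \<and> b divides a [^] n"
  with b show "assoc_class R b \<in> basic_open R a" unfolding basic_open_def by blast
qed

lemma (in cring) assoc_class_in_own_basic_open:
  assumes a: "a \<in> nonzero_nonunits R"
  shows "assoc_class R a \<in> basic_open R a"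
proof -
  have "a divides a [^] (1::nat)" using a by (simp add: nonzero_nonunits_def)
  with a show ?thesis unfolding assoc_class_in_basic_open_iff[OF a a] by blast
qed

text \<open>Transitivity of dividing a power: from \<open>c\<close> dividing \<open>b ^ m\<close> and \<open>b\<close> dividing \<open>a ^ n\<close>
  it follows that \<open>c\<close> divides \<open>(a ^ n) ^ m\<close>.\<close>

lemma (in cring) basic_open_mono:
  assumes a: "a \<in> nonzero_nonunits R" and b: "b \<in> nonzero_nonunits R"
    and ba: "assoc_class R b \<in> basic_open R a"
  shows "basic_open R b \<subseteq> basic_open R a"
proof
  fix x assume "x \<in> basic_open R b"
  then obtain c m where c: "x = assoc_class R c" "c \<in> nonzero_nonunits R"
    "(m::nat) \<ge> 1" "c divides b [^] m"
    unfolding basic_open_def by blast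
  obtain n :: nat where n: "n \<ge> 1" "b divides a [^] n"
    using ba assoc_class_in_basic_open_iff[OF b a] by blast
  have carr: "a \<in> carrier R" "b \<in> carrier R" "c \<in> carrier R"
    using a b c(2) by (auto simp: nonzero_nonunits_def)
  have "b [^] m divides (a [^] n) [^] m" using pow_divides_pow n carr by simp
  with c carr have "c divides a [^] (n * m)"
    by (metis divides_trans nat_pow_pow)
  moreover have "n * m \<ge> 1" using n c(3) by simp
  ultimately show "x \<in> basic_open R a"
    using c(1) assoc_class_in_basic_open_iff[OF c(2) a] by blast
qed

theorem proposition1p2:
  fixes R :: "('a, 'b) ring_scheme"
  assumes "cring R" and "\<one>\<^bsub>R\<^esub> \<noteq> \<zero>\<^bsub>R\<^esub>"
  shows "base_for_topology_on (EC R) (basic_opens R)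
    \<and> topspace (GD R) = EC R \<and> topology_base (GD R) (basic_opens R)
    \<and> (\<forall>a \<in> nonzero_nonunits R. smallest_open_nhd (GD R) (assoc_class R a) (basic_open R a))
    \<and> Alexandrov_space (GD R)"
proof -
  interpret cring R by fact
  let ?I = "nonzero_nonunits R"
  have points: "basic_open R a \<subseteq> assoc_class R ` ?I" for a
    unfolding basic_open_def by blast
  have "istopology (arbitrary union_of (\<lambda>U. U \<in> basic_opens R))"
    unfolding basic_opens_eq_image
    by (rule istopology_principal_sets[where p = "assoc_class R"])
      (rule assoc_class_in_own_basic_open points basic_open_mono; assumption)+
  then have base: "topology_base (GD R) (basic_opens R)"
    unfolding topology_base_def GD_def by (simp add: topology_inverse')
  have nhd: "smallest_open_nhd (GD R) (assoc_class R a) (basic_open R a)" if "a \<in> ?I" for a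
    by (rule smallest_open_nhd_principal_set[where p = "assoc_class R",
          OF base[unfolded basic_opens_eq_image]])
      ((rule assoc_class_in_own_basic_open basic_open_mono; assumption) | rule that)+
  have space: "topspace (GD R) = EC R"
  proof
    show "EC R \<subseteq> topspace (GD R)"
      using nhd openin_subset unfolding EC_eq_image smallest_open_nhd_def by blast
    have "(arbitrary union_of (\<lambda>U. U \<in> basic_opens R)) (topspace (GD R))"
      using base unfolding topology_base_def by (metis openin_topspace)
    then show "topspace (GD R) \<subseteq> EC R"
      unfolding arbitrary_union_of_alt EC_eq_image basic_opens_eq_image using points by blast
  qed
  have "Alexandrov_space (GD R)"
    unfolding Alexandrov_space_def space EC_eq_image using nhd by blast
  with base space nhd show ?thesis unfolding base_for_topology_on_def by blast
qed

end
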